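(* Let $G$ be a group, let $x\in G$, and let $\sigma_x:G\to G$ be the inner automorphism $\sigma_x(g)=xgx^{-1}$. Then $G$ is a $(\sigma_x,\sigma_x)$-$FC$ group if and only if $G$ is an $FC$-group.
   Context: For endomorphisms $\sigma,\tau$ of $G$, the $(\sigma,\tau)$-conjugacy class of $a\in G$ is $[a]_{\sigma,\tau}=\{\sigma(v)a\tau(v^{-1}) : v\in G\}$. $G$ is a $(\sigma,\tau)$-$FC$ group if every $(\sigma,\tau)$-conjugacy class is finite. $G$ is an $FC$-group if every ordinary conjugacy class is finite. *)

theory Defs
  imports "HOL-Algebra.Group_Action"
begin

definition twisted_conj_class ::
  "('a, 'b) monoid_scheme \<Rightarrow> ('a \<Rightarrow> 'a) \<Rightarrow> ('a \<Rightarrow> 'a) \<Rightarrow> 'a \<Rightarrow> 'a set"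
  where "twisted_conj_class G \<sigma> \<tau> a =
    {\<sigma> v \<otimes>\<^bsub>G\<^esub> a \<otimes>\<^bsub>G\<^esub> \<tau> (inv\<^bsub>G\<^esub> v) | v. v \<in> carrier G}"

definition conj_class :: "('a, 'b) monoid_scheme \<Rightarrow> 'a \<Rightarrow> 'a set"
  where "conj_class G a = {v \<otimes>\<^bsub>G\<^esub> a \<otimes>\<^bsub>G\<^esub> inv\<^bsub>G\<^esub> v | v. v \<in> carrier G}"

locale twisted_FC_group = group G for G (structure) +
  fixes \<sigma> \<tau> :: "'a \<Rightarrow> 'a"
  assumes left_endo: "\<sigma> \<in> hom G G"
    and right_endo: "\<tau> \<in> hom G G"
    and finite_twisted_conj_class: "a \<in> carrier G \<Longrightarrow> finite (twisted_conj_class G \<sigma> \<tau> a)"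

locale FC_group = group G for G (structure) +
  assumes finite_conj_class: "a \<in> carrier G \<Longrightarrow> finite (conj_class G a)"

text \<open>
  The function is restricted to the carrier because \<open>auto G\<close> contains only
  extensional functions.
\<close>

definition inner_auto :: "('a, 'b) monoid_scheme \<Rightarrow> 'a \<Rightarrow> 'a \<Rightarrow> 'a"
  where "inner_auto G x = (\<lambda>g \<in> carrier G. x \<otimes>\<^bsub>G\<^esub> g \<otimes>\<^bsub>G\<^esub> inv\<^bsub>G\<^esub> x)"

lemma (in group) inner_auto_in_auto:
  assumes x: "x \<in> carrier G"
  shows "inner_auto G x \<in> auto G"
proof -
  have cancel: "inv x \<otimes> (x \<otimes> y) = y" if "y \<in> carrier G" for y
    using that x by (simp flip: m_assoc)
  have "x \<otimes> (g \<otimes> h) \<otimes> inv x = (x \<otimes> g \<otimes> inv x) \<otimes> (x \<otimes> h \<otimes> inv x)"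
    if "g \<in> carrier G" "h \<in> carrier G" for g h
    using that x by (simp add: m_assoc cancel)
  then have "inner_auto G x \<in> hom G G"
    using x by (auto simp: inner_auto_def hom_def)
  moreover have "inner_auto G x \<in> Bij (carrier G)"
    using conjugation_is_bij[OF x] by (simp add: inner_auto_def Bij_def)
  ultimately show ?thesis
    by (simp add: auto_def)
qed

end

theory Submission
  imports Defs
begin

text \<open>
  An endomorphism commutes with inversion, so \<open>\<sigma> v \<otimes> a \<otimes> \<sigma> (inv v)\<close> is the ordinary
  conjugate of \<open>a\<close> by \<open>\<sigma> v\<close>. When \<open>\<sigma>\<close> is onto, \<open>\<sigma> v\<close> ranges over the whole group, and the
  \<open>(\<sigma>, \<sigma>)\<close>-class of \<open>a\<close> is exactly its conjugacy class
  (\<open>twisted_conj_class_eq_conj_class\<close>). An inner automorphism is such a \<open>\<sigma>\<close>, so the two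
  finiteness conditions are about the same sets.
\<close>

text \<open>
  For any endomorphism \<open>\<sigma>\<close> the left side is the orbit of \<open>a\<close> under conjugation by the image
  of \<open>\<sigma>\<close>. Surjectivity makes that image the whole group; for the trivial endomorphism, by
  contrast, the left side is \<open>{a}\<close> for every \<open>a\<close> in the group.
\<close>

lemma (in group) twisted_conj_class_eq_conj_class:
  assumes hom: "\<sigma> \<in> hom G G"
    and onto: "\<sigma> ` carrier G = carrier G"
  shows "twisted_conj_class G \<sigma> \<sigma> a = conj_class G a"
proof -
  interpret \<sigma>: group_hom G G \<sigma>
    using hom by unfold_locales
  have "twisted_conj_class G \<sigma> \<sigma> a = (\<lambda>v. \<sigma> v \<otimes> a \<otimes> inv \<sigma> v) ` carrier G"
    unfolding twisted_conj_class_def Setcompr_eq_image by (intro image_cong) simp_all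
  also have "\<dots> = (\<lambda>w. w \<otimes> a \<otimes> inv w) ` (\<sigma> ` carrier G)"
    by (simp add: image_image)
  also have "\<dots> = conj_class G a"
    by (auto simp: onto conj_class_def)
  finally show ?thesis .
qed

theorem proposition9:
  fixes G (structure)
  assumes "group G"
    and "x \<in> carrier G"
  shows "twisted_FC_group G (inner_auto G x) (inner_auto G x) \<longleftrightarrow> FC_group G"
proof -
  interpret group G by fact
  have "inner_auto G x \<in> auto G"
    using assms(2) by (rule inner_auto_in_auto)
  then have hom: "inner_auto G x \<in> hom G G"
    and onto: "inner_auto G x ` carrier G = carrier G"
    by (auto simp: auto_def Bij_def bij_betw_def)
  show ?thesis
    unfolding twisted_FC_group_def twisted_FC_group_axioms_def
      FC_group_def FC_group_axioms_def
    by (simp add: hom twisted_conj_class_eq_conj_class[OF hom onto])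
qed

end
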